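(* Let $N\ge2$, let $\mathcal U=\prod_{i=1}^N\mathcal U_i\subset(\frac12\mathbb Z)^N$, and let $u_i$ be real sequences, $u_i(n_i+\frac14)$ being defined whenever $n_i,n_i+\frac12\in\mathcal U_i$, with $u_i(m+\frac12)\neq u_i(m)$ and $u_i(m)\neq u_j(m')$ for all $i\ne j$ and all $m,m'$. Consider the discrete Euler-Poisson-Darboux system with $\gamma=\frac12$ for a function $x:\mathcal U\to\mathbb R$: $$\Delta_i\Delta_jx=\frac1{u_i-u_j}\big(\Delta^{1/2}u_i\,\Delta_jx-\Delta^{1/2}u_j\,\Delta_ix\big),\qquad i\ne j,\qquad(\mathrm{dEPD})$$ where $x=x(\boldsymbol n)$, $u_i=u_i(n_i+\frac14)$, $\Delta_if(\boldsymbol n)=f(\boldsymbol n+\boldsymbol e_i)-f(\boldsymbol n)$, $\Delta^{1/2}u_i=u_i(n_i+\frac34)-u_i(n_i+\frac14)$, required for all $\boldsymbol n$ with $\boldsymbol n,\boldsymbol n+\boldsymbol e_i,\boldsymbol n+\boldsymbol e_j,\boldsymbol n+\boldsymbol e_i+\boldsymbol e_j\in\mathcal U$. (1) Let $a_1>\cdots>a_N$ with $u_i(m)\ne-a_k$ for all $i,k,m$. Then all components $x_k$ of the discrete confocal coordinates $$x_k(\boldsymbol n)=\frac{\prod_{j=1}^Nf_j^k(n_j)}{\prod_{i<k}\sqrt{a_i-a_k}\prod_{i>k}\sqrt{a_k-a_i}},\qquad f_i^k(n_i)f_i^k(n_i+\tfrac12)=\begin{cases}u_i(n_i+\frac14)+a_k,&k\le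 i,\\-(u_i(n_i+\frac14)+a_k),&k>i,\end{cases}\qquad(\ast)$$ satisfy (dEPD). (2) Conversely, let $x_1,\dots,x_N$ be $N$ independent factorized solutions $x_k(\boldsymbol n)=\prod_{i=1}^Nf_i^{(k)}(n_i)$ of (dEPD) on $\mathcal U$, with values $x_k>0$ and positive discrete squares $f_i^{(k)}(n_i)f_i^{(k)}(n_i+\frac12)>0$ for all $i,k,n_i$. Then each $x_k$ has a real separation constant $a_k$, i.e. $$\frac{f_i^{(k)}(n_i+1)}{f_i^{(k)}(n_i)}=\frac{u_i(n_i+\frac34)+a_k}{u_i(n_i+\frac14)+a_k}\quad\text{for all } i,n_i,$$ and if, after numbering the solutions so that $a_1>\cdots>a_N$, the domain is such that $$-a_1<u_1(n_1+\tfrac14)<-a_2<u_2(n_2+\tfrac14)<\cdots<-a_N<u_N(n_N+\tfrac14)\quad\text{on }\mathcal U,$$ then the net $\boldsymbol x=(x_1,\dots,x_N):\mathcal U\to\mathbb R^N$ coincides with discrete confocal coordinates of the form $(\ast)$ in the first hyperoctant, up to independent scaling along the coordinate axes $(x_1,\dots,x_N)\to(C_1x_1,\dots,C_Nx_N)$ with some constants $C_1,\dots,C_N>0$.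
   Context: Each $\mathcal U_i$ is a set of consecutive elements of $\frac12\mathbb Z$ (finite or infinite) with at least three elements; $\boldsymbol e_i$ is the $i$-th coordinate unit vector. "Independent" means that $\boldsymbol x=(x_1,\dots,x_N)$ is a discrete coordinate system: at every $\boldsymbol n\in\mathcal U$, for every way of choosing, for each $j$, one of the vectors $\boldsymbol x(\boldsymbol n+\boldsymbol e_j)-\boldsymbol x(\boldsymbol n)$, $\boldsymbol x(\boldsymbol n)-\boldsymbol x(\boldsymbol n-\boldsymbol e_j)$ (as far as the points involved lie in $\mathcal U$), the $N$ chosen vectors are linearly independent. The first hyperoctant is $\{x_1>0,\dots,x_N>0\}$. *)

theory Defs
  imports "HOL-Analysis.Analysis"
begin

text \<open>
  Directions and components are indexed by a finite linearly ordered type \<open>'n\<close> with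
  \<open>N = CARD('n)\<close>; its order plays the role of the order of \<open>1, \<dots>, N\<close>.
  Half-integers are real numbers, so lattice points are vectors in \<open>real ^ 'n\<close>
  (spelled \<open>(real, 'n) vec\<close> where \<open>'n\<close> has sort \<open>{finite,linorder}\<close>).  All functions are
  total, and only their values on the relevant discrete domains are constrained.
\<close>

definition half_ints :: "real set" where
  "half_ints = {t. 2 * t \<in> \<int>}"

definition consecutive_half_ints :: "real set \<Rightarrow> bool" where
  "consecutive_half_ints S \<longleftrightarrow>
     S \<subseteq> half_ints \<and> (\<forall>a\<in>S. \<forall>b\<in>S. half_ints \<inter> {a..b} \<subseteq> S)"

text \<open>The points \<open>t + 1/4\<close> at which \<open>u\<^sub>i\<close> is defined, for \<open>S = \<U>\<^sub>i\<close>.\<close>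

definition quarter_points :: "real set \<Rightarrow> real set" where
  "quarter_points S = {t + 1/4 | t. t \<in> S \<and> t + 1/2 \<in> S}"

definition grid :: "('n::finite \<Rightarrow> real set) \<Rightarrow> (real ^ 'n) set" where
  "grid U = {n. \<forall>i. n $ i \<in> U i}"

definition Delta :: "'n::finite \<Rightarrow> (real ^ 'n \<Rightarrow> real) \<Rightarrow> real ^ 'n \<Rightarrow> real" where
  "Delta i x n = x (n + axis i 1) - x n"

definition half_Delta :: "(real \<Rightarrow> real) \<Rightarrow> real \<Rightarrow> real" where
  "half_Delta v m = v (m + 1/2) - v m"

definition dEPD ::
  "('n::finite \<Rightarrow> real set) \<Rightarrow> ('n \<Rightarrow> real \<Rightarrow> real) \<Rightarrow> (real ^ 'n \<Rightarrow> real) \<Rightarrow> bool" where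
  "dEPD U u x \<longleftrightarrow>
     (\<forall>i j n. i \<noteq> j \<and> n \<in> grid U \<and> n + axis i 1 \<in> grid U \<and> n + axis j 1 \<in> grid U \<and>
        n + axis i 1 + axis j 1 \<in> grid U \<longrightarrow>
        Delta i (Delta j x) n =
          1 / (u i (n $ i + 1/4) - u j (n $ j + 1/4)) *
          (half_Delta (u i) (n $ i + 1/4) * Delta j x n
           - half_Delta (u j) (n $ j + 1/4) * Delta i x n))"

text \<open>
  The family \<open>v\<close> ranges over all choices of one forward or backward difference vector per
  direction.  At a point where some direction admits neither (the middle one of three
  elements of \<open>\<U>\<^sub>j\<close>), there is no such choice and hence no condition.
  Linear independence is that of the family, whence \<open>inj v\<close>.
\<close>

definition discrete_coordinate_system ::
  "('n::finite \<Rightarrow> real set) \<Rightarrow> (real ^ 'n \<Rightarrow> real ^ 'n) \<Rightarrow> bool" where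
  "discrete_coordinate_system U x \<longleftrightarrow>
     (\<forall>n \<in> grid U. \<forall>v :: 'n \<Rightarrow> real ^ 'n.
        (\<forall>j. (n + axis j 1 \<in> grid U \<and> v j = x (n + axis j 1) - x n) \<or>
             (n - axis j 1 \<in> grid U \<and> v j = x n - x (n - axis j 1))) \<longrightarrow>
        inj v \<and> independent (range v))"

text \<open>In the following, \<open>f k i t\<close> stands for \<open>f\<^sub>i\<^sup>k(t)\<close>.\<close>

definition factorized ::
  "('n::finite \<Rightarrow> real set) \<Rightarrow> ('n \<Rightarrow> 'n \<Rightarrow> real \<Rightarrow> real) \<Rightarrow> (real ^ 'n \<Rightarrow> real ^ 'n) \<Rightarrow> bool" where
  "factorized U f x \<longleftrightarrow> (\<forall>n \<in> grid U. \<forall>k. x n $ k = (\<Prod>i\<in>UNIV. f k i (n $ i)))"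

definition confocal ::
  "('n::{finite,linorder} \<Rightarrow> real set) \<Rightarrow> ('n \<Rightarrow> real \<Rightarrow> real) \<Rightarrow> ('n \<Rightarrow> real) \<Rightarrow>
   ((real, 'n) vec \<Rightarrow> (real, 'n) vec) \<Rightarrow> bool" where
  "confocal U u a x \<longleftrightarrow>
     (\<exists>f.
        (\<forall>k i t. t \<in> U i \<and> t + 1/2 \<in> U i \<longrightarrow>
           f k i t * f k i (t + 1/2) =
             (if k \<le> i then u i (t + 1/4) + a k else - (u i (t + 1/4) + a k))) \<and>
        (\<forall>n \<in> grid U. \<forall>k.
           x n $ k = (\<Prod>j\<in>UNIV. f k j (n $ j)) /
             ((\<Prod>i\<in>{..<k}. sqrt (a i - a k)) * (\<Prod>i\<in>{k<..}. sqrt (a k - a i)))))"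

text \<open>
  Here \<open>g i\<close> are the factors of a single solution.  The first conjunct is the implicit
  requirement that the fraction on the right is defined.
\<close>

definition separation_constant ::
  "('n \<Rightarrow> real set) \<Rightarrow> ('n \<Rightarrow> real \<Rightarrow> real) \<Rightarrow> ('n \<Rightarrow> real \<Rightarrow> real) \<Rightarrow> real \<Rightarrow> bool" where
  "separation_constant U u g a \<longleftrightarrow>
     (\<forall>i t. t \<in> U i \<and> t + 1 \<in> U i \<longrightarrow>
        u i (t + 1/4) + a \<noteq> 0 \<and>
        g i (t + 1) / g i t = (u i (t + 3/4) + a) / (u i (t + 1/4) + a))"

definition strictly_decreasing :: "('n::linorder \<Rightarrow> real) \<Rightarrow> bool" where
  "strictly_decreasing a \<longleftrightarrow> (\<forall>i j. i < j \<longrightarrow> a i > a j)"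

text \<open>
  The chain \<open>-a\<^sub>1 < u\<^sub>1 < -a\<^sub>2 < \<dots> < -a\<^sub>N < u\<^sub>N\<close>.  For decreasing \<open>a\<close>, the upper bound
  by all \<open>-a\<^sub>j\<close> with \<open>j > i\<close> is the one by \<open>-a\<^sub>i\<^sub>+\<^sub>1\<close>, and absent for the last index.
\<close>

definition interlacing ::
  "('n::linorder \<Rightarrow> real set) \<Rightarrow> ('n \<Rightarrow> real \<Rightarrow> real) \<Rightarrow> ('n \<Rightarrow> real) \<Rightarrow> bool" where
  "interlacing U u a \<longleftrightarrow>
     (\<forall>i. \<forall>m \<in> quarter_points (U i). - a i < u i m \<and> (\<forall>j>i. u i m < - a j))"

end

theory Submission
  imports Defs
begin

text \<open>
  The whole theorem is separation of variables.  For a factorized function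
  \<open>h n = c * (\<Prod>i. g i (n $ i))\<close> a unit step in direction \<open>i\<close> multiplies \<open>h\<close> by a ratio
  \<open>\<rho>\<^sub>i\<close> that depends on \<open>n $ i\<close> only.  Dividing the Euler-Poisson-Darboux equation by \<open>h n\<close>
  turns it into the scalar relation
  \<open>(\<rho>\<^sub>i - 1) (\<rho>\<^sub>j - 1) (u\<^sub>i - u\<^sub>j) = d\<^sub>i (\<rho>\<^sub>j - 1) - d\<^sub>j (\<rho>\<^sub>i - 1)\<close>,
  where \<open>d\<^sub>i\<close> is the half-step difference of \<open>u\<^sub>i\<close>
  (lemma \<open>dEPD_separated\<close>).  When no \<open>\<rho>\<^sub>i\<close> equals \<open>1\<close>, it says that \<open>d\<^sub>i / (\<rho>\<^sub>i - 1) - u\<^sub>i\<close>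
  takes the same value for \<open>i\<close> and for \<open>j\<close>; these two expressions depend on different
  variables, so they are a constant \<open>a\<close>, and
  \<open>\<rho>\<^sub>i = 1 + d\<^sub>i / (u\<^sub>i + a)\<close> is the asserted quotient.  Conversely, ratios of this form
  solve the relation, and the confocal coordinates have them because the prescribed
  products \<open>f(t) f(t + 1/2)\<close> determine \<open>f(t + 1) / f(t)\<close>.

  Independence of the solutions enters through one fact (\<open>common_normal_zero\<close>): at a point
  with forward neighbours in all directions no nonzero vector is orthogonal to all forward
  differences.  If some \<open>\<rho>\<^sub>i\<close> of the \<open>k\<close>-th solution were \<open>1\<close>, all of them would be, and the
  \<open>k\<close>-th unit vector would be such a normal; if two solutions had the same separation
  constant, their logarithmic differences would agree, which again gives a normal.  So the
  constants exist and are distinct, and they can be put in decreasing order.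

  Finally, the separated quotient says that \<open>f(t) f(t + 1/2) / (u(t + 1/4) + a)\<close> does not
  change under half steps (\<open>half_step_products_proportional\<close>).  The interlacing condition
  fixes the sign of \<open>u + a\<close> to be the one prescribed for confocal coordinates, so this
  constant is absorbed into a positive rescaling of \<open>f\<close>.
\<close>

section \<open>Consecutive half-integers\<close>

lemma half_ints_add_half: "t \<in> half_ints \<Longrightarrow> t + 1/2 \<in> half_ints"
  by (simp add: half_ints_def distrib_left)

lemma half_ints_less_imp_half_step:
  assumes "s \<in> half_ints" "t \<in> half_ints" "s < t"
  shows "s + 1/2 \<le> t"
proof -
  obtain p q where "2 * s = of_int p" "2 * t = of_int q"
    using assms(1,2) by (auto simp: half_ints_def elim!: Ints_cases)
  moreover from this have "p < q" using assms(3) by linarith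
  ultimately show ?thesis by linarith
qed

lemma consecutive_half_ints_between:
  assumes "consecutive_half_ints S" "s \<in> S" "t \<in> S" "r \<in> half_ints" "s \<le> r" "r \<le> t"
  shows "r \<in> S"
  using assms unfolding consecutive_half_ints_def by fastforce

lemma consecutive_half_ints_mid:
  assumes "consecutive_half_ints S" "t \<in> S" "t + 1 \<in> S"
  shows "t + 1/2 \<in> S"
proof (rule consecutive_half_ints_between[OF assms])
  show "t + 1/2 \<in> half_ints"
    using assms half_ints_add_half unfolding consecutive_half_ints_def by blast
qed auto

lemma quarter_points_of_unit_step:
  assumes "consecutive_half_ints S" "t \<in> S" "t + 1 \<in> S"
  shows "t + 1/4 \<in> quarter_points S" "t + 3/4 \<in> quarter_points S"
proof -
  have mid: "t + 1/2 \<in> S" by (rule consecutive_half_ints_mid[OF assms])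
  have qp: "s + 1/4 \<in> quarter_points S" if "s \<in> S" "s + 1/2 \<in> S" for s
    using that unfolding quarter_points_def by blast
  show "t + 1/4 \<in> quarter_points S" by (rule qp[OF assms(2) mid])
  show "t + 3/4 \<in> quarter_points S" using qp[OF mid] assms(3) by (simp add: add.assoc)
qed

text \<open>
  The three-point hypothesis is there to make room for one unit step: the outer two of three
  half-integers are at distance at least \<open>1\<close>.
\<close>

lemma unit_step_exists:
  assumes S: "consecutive_half_ints S" and "finite S \<Longrightarrow> card S \<ge> 3"
  shows "\<exists>t. t \<in> S \<and> t + 1 \<in> S"
proof -
  obtain T where T: "T \<subseteq> S" "card T = 3"
    using assms(2) by (metis infinite_arbitrarily_large obtain_subset_with_card_n)
  then obtain p q r where pqr: "T = {p, q, r}" "p \<noteq> q" "p \<noteq> r" "q \<noteq> r"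
    by (auto simp: card_3_iff)
  have "\<exists>x y z. x \<in> S \<and> y \<in> S \<and> z \<in> S \<and> x < y \<and> y < z"
    using pqr T(1) by (metis insert_subset linorder_neqE_linordered_idom)
  then obtain x y z where xyz: "x \<in> S" "y \<in> S" "z \<in> S" "x < y" "y < z" by blast
  have H: "S \<subseteq> half_ints" using S by (simp add: consecutive_half_ints_def)
  have "x + 1/2 \<le> y" "y + 1/2 \<le> z"
    using half_ints_less_imp_half_step H xyz by blast+
  moreover have "x + 1 \<in> half_ints"
    using half_ints_add_half[OF half_ints_add_half, of x] H xyz(1) by (auto simp: add.assoc)
  ultimately have "x + 1 \<in> S"
    by (intro consecutive_half_ints_between[OF S xyz(1,3)]) auto
  then show ?thesis using xyz(1) by blast
qed

lemma half_step_invariant_const: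
  fixes \<phi> :: "real \<Rightarrow> real"
  assumes S: "consecutive_half_ints S"
    and step: "\<And>t. t \<in> S \<Longrightarrow> t + 1 \<in> S \<Longrightarrow> \<phi> (t + 1/2) = \<phi> t"
    and s: "s \<in> S" "s + 1/2 \<in> S" and t: "t \<in> S" "t + 1/2 \<in> S"
  shows "\<phi> s = \<phi> t"
proof -
  have H: "S \<subseteq> half_ints" using S by (simp add: consecutive_half_ints_def)
  have aux: "\<phi> (r + real m / 2) = \<phi> r" if "r \<in> S" "r + real m / 2 + 1/2 \<in> S" for r m
    using that
  proof (induction m)
    case 0
    then show ?case by simp
  next
    case (Suc m)
    let ?q = "r + real m / 2"
    have eqs: "r + real (Suc m) / 2 = ?q + 1/2" "r + real (Suc m) / 2 + 1/2 = ?q + 1"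
      by (simp_all add: add_divide_distrib)
    have "2 * ?q = 2 * r + real m" by simp
    then have hq: "?q \<in> half_ints"
      using H Suc.prems(1) unfolding half_ints_def by (auto simp: algebra_simps)
    have q1: "?q + 1 \<in> S" using Suc.prems(2) unfolding eqs(2) .
    have q: "?q \<in> S"
      by (rule consecutive_half_ints_between[OF S Suc.prems(1) q1 hq]) auto
    have "\<phi> (?q + 1/2) = \<phi> ?q" by (rule step[OF q q1])
    then show ?case
      unfolding eqs(1) using Suc.IH[OF Suc.prems(1) consecutive_half_ints_mid[OF S q q1]] by (rule trans)
  qed
  have ordered: "\<phi> s = \<phi> t"
    if "s \<le> t" "s \<in> S" "t \<in> S" "t + 1/2 \<in> S" for s t
  proof -
    have "s \<in> half_ints" "t \<in> half_ints" using that H by auto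
    then obtain p q where pq: "2 * s = of_int p" "2 * t = of_int q"
      by (auto simp: half_ints_def elim!: Ints_cases)
    then have "p \<le> q" using that(1) by linarith
    then have "real (nat (q - p)) = of_int q - of_int p" by simp
    with pq have "t = s + real (nat (q - p)) / 2" by linarith
    then show ?thesis using aux[of s "nat (q - p)"] that by simp
  qed
  show ?thesis
  proof (cases "s \<le> t")
    case True
    then show ?thesis by (rule ordered[OF _ s(1) t])
  next
    case False
    then have "t \<le> s" by simp
    then show ?thesis by (rule ordered[OF _ t(1) s, symmetric])
  qed
qed

section \<open>Factorized functions and separation of variables\<close>

lemma factorized_unit_step:
  fixes g :: "'n::finite \<Rightarrow> real \<Rightarrow> real"
  assumes h: "\<And>m. m \<in> grid U \<Longrightarrow> h m = c * (\<Prod>i\<in>UNIV. g i (m $ i))"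
    and n: "n \<in> grid U" "n + axis i 1 \<in> grid U"
    and gi: "g i (n $ i) \<noteq> 0"
  shows "h (n + axis i 1) = h n * (g i (n $ i + 1) / g i (n $ i))"
proof -
  have rest: "(\<Prod>l\<in>UNIV - {i}. g l ((n + axis i 1) $ l)) = (\<Prod>l\<in>UNIV - {i}. g l (n $ l))"
    by (rule prod.cong) (auto simp: axis_def)
  have split: "(\<Prod>l\<in>UNIV. g l (m $ l)) = g i (m $ i) * (\<Prod>l\<in>UNIV - {i}. g l (m $ l))" for m
    by (rule prod.remove) auto
  have i: "(n + axis i 1) $ i = n $ i + 1" by (simp add: axis_def)
  show ?thesis
    unfolding h[OF n(1)] h[OF n(2)] split rest i using gi by simp
qed

text \<open>
  Both parts of the theorem rest on this equivalence at a single lattice point.  The constant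
  \<open>c\<close> accommodates the normalizing denominators of confocal coordinates.
\<close>

lemma dEPD_separated:
  fixes g :: "'n::finite \<Rightarrow> real \<Rightarrow> real"
  assumes h: "\<And>m. m \<in> grid U \<Longrightarrow> h m = c * (\<Prod>i\<in>UNIV. g i (m $ i))"
    and ij: "i \<noteq> j"
    and grid: "n \<in> grid U" "n + axis i 1 \<in> grid U" "n + axis j 1 \<in> grid U"
      "n + axis i 1 + axis j 1 \<in> grid U"
    and gi: "g i (n $ i) \<noteq> 0" and gj: "g j (n $ j) \<noteq> 0" and hn: "h n \<noteq> 0"
    and uij: "ui \<noteq> uj"
  defines "A \<equiv> g i (n $ i + 1) / g i (n $ i) - 1"
    and "B \<equiv> g j (n $ j + 1) / g j (n $ j) - 1"
  shows "Delta i (Delta j h) n = 1 / (ui - uj) * (di * Delta j h n - dj * Delta i h n) \<longleftrightarrow>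
    A * B * (ui - uj) = di * B - dj * A"
proof -
  have hi: "h (n + axis i 1) = h n * (A + 1)"
    unfolding A_def using factorized_unit_step[where h = h and g = g, OF h grid(1,2) gi] by simp
  have hj: "h (n + axis j 1) = h n * (B + 1)"
    unfolding B_def using factorized_unit_step[where h = h and g = g, OF h grid(1,3) gj] by simp
  have nj: "(n + axis i 1) $ j = n $ j" using ij by (simp add: axis_def)
  have hij: "h (n + axis i 1 + axis j 1) = h n * (A + 1) * (B + 1)"
    unfolding B_def hi[symmetric]
    using factorized_unit_step[where h = h and g = g, OF h grid(2,4)] gj unfolding nj by simp
  have *: "Delta i h n = h n * A" "Delta j h n = h n * B"
    "Delta i (Delta j h) n = h n * (A * B)"
    unfolding Delta_def hi hj hij by (simp_all add: algebra_simps)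
  have "Delta i (Delta j h) n = 1 / (ui - uj) * (di * Delta j h n - dj * Delta i h n) \<longleftrightarrow>
    h n * (A * B * (ui - uj)) = h n * (di * B - dj * A)"
    unfolding * using uij by (auto simp: field_simps)
  then show ?thesis using hn by simp
qed

section \<open>Confocal coordinates are solutions\<close>

lemma half_step_products_quotient:
  fixes g v :: "real \<Rightarrow> real"
  assumes e: "e \<noteq> 0"
    and p: "g t * g (t + 1/2) = e * (v (t + 1/4) + a)"
    and q: "g (t + 1/2) * g (t + 1) = e * (v (t + 3/4) + a)"
    and nz: "v (t + 1/4) + a \<noteq> 0"
  shows "g t \<noteq> 0" "g (t + 1) / g t = (v (t + 3/4) + a) / (v (t + 1/4) + a)"
proof -
  have nz': "g t * g (t + 1/2) \<noteq> 0" using p e nz by simp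
  then show "g t \<noteq> 0" by auto
  have "g (t + 1) / g t = (g (t + 1/2) * g (t + 1)) / (g t * g (t + 1/2))"
    using nz' by simp
  also have "\<dots> = (v (t + 3/4) + a) / (v (t + 1/4) + a)"
    unfolding p q using e by simp
  finally show "g (t + 1) / g t = (v (t + 3/4) + a) / (v (t + 1/4) + a)" .
qed

text \<open>
  The signs \<open>e i\<close> distinguish the two cases in the definition of confocal coordinates.
\<close>

lemma dEPD_of_half_step_products:
  fixes U :: "'n::finite \<Rightarrow> real set" and u :: "'n \<Rightarrow> real \<Rightarrow> real"
  assumes U: "\<And>i. consecutive_half_ints (U i)"
    and u: "\<And>i j m m'. i \<noteq> j \<Longrightarrow> m \<in> quarter_points (U i) \<Longrightarrow> m' \<in> quarter_points (U j) \<Longrightarrow>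
           u i m \<noteq> u j m'"
    and ua: "\<And>i m. m \<in> quarter_points (U i) \<Longrightarrow> u i m + a \<noteq> 0"
    and e: "\<And>i. e i \<noteq> 0"
    and g: "\<And>i t. t \<in> U i \<Longrightarrow> t + 1/2 \<in> U i \<Longrightarrow> g i t * g i (t + 1/2) = e i * (u i (t + 1/4) + a)"
    and h: "\<And>m. m \<in> grid U \<Longrightarrow> h m = c * (\<Prod>i\<in>UNIV. g i (m $ i))"
  shows "dEPD U u h"
  unfolding dEPD_def
proof (intro allI impI, elim conjE)
  fix i j n
  assume ij: "i \<noteq> j" and grid: "n \<in> grid U" "n + axis i 1 \<in> grid U" "n + axis j 1 \<in> grid U"
    "n + axis i 1 + axis j 1 \<in> grid U"
  have step: "n $ l \<in> U l \<and> n $ l + 1 \<in> U l" if "n + axis l 1 \<in> grid U" for l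
  proof -
    have "(n + axis l 1) $ l \<in> U l" "n $ l \<in> U l" using that grid(1) unfolding grid_def by blast+
    then show ?thesis by (simp add: axis_def)
  qed
  have q: "g l (n $ l) \<noteq> 0" "n $ l + 1/4 \<in> quarter_points (U l)"
    "u l (n $ l + 1/4) + a \<noteq> 0"
    "g l (n $ l + 1) / g l (n $ l) = (u l (n $ l + 3/4) + a) / (u l (n $ l + 1/4) + a)"
    if l: "n + axis l 1 \<in> grid U" for l
  proof -
    let ?t = "n $ l"
    have t: "?t \<in> U l" "?t + 1 \<in> U l" using step[OF l] by auto
    have m: "?t + 1/2 \<in> U l" by (rule consecutive_half_ints_mid[OF U t])
    show qp: "?t + 1/4 \<in> quarter_points (U l)"
      by (rule quarter_points_of_unit_step[OF U t])
    show nz: "u l (?t + 1/4) + a \<noteq> 0" by (rule ua[OF qp])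
    have "g l ?t * g l (?t + 1/2) = e l * (u l (?t + 1/4) + a)"
      by (rule g[OF t(1) m])
    moreover have "g l (?t + 1/2) * g l (?t + 1) = e l * (u l (?t + 3/4) + a)"
      using g[OF m] t(2) by (simp add: add.assoc)
    ultimately show "g l ?t \<noteq> 0"
      "g l (?t + 1) / g l ?t = (u l (?t + 3/4) + a) / (u l (?t + 1/4) + a)"
      using half_step_products_quotient[where g = "g l" and v = "u l", OF e _ _ nz] by blast+
  qed
  let ?ui = "u i (n $ i + 1/4)" and ?uj = "u j (n $ j + 1/4)"
  have uij: "?ui \<noteq> ?uj" by (rule u[OF ij q(2)[OF grid(2)] q(2)[OF grid(3)]])
  show "Delta i (Delta j h) n = 1 / (?ui - ?uj) *
    (half_Delta (u i) (n $ i + 1/4) * Delta j h n - half_Delta (u j) (n $ j + 1/4) * Delta i h n)"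
  proof (cases "h n = 0")
    case False
    have r: "g l (n $ l + 1) / g l (n $ l) - 1 =
        half_Delta (u l) (n $ l + 1/4) / (u l (n $ l + 1/4) + a)"
      if "n + axis l 1 \<in> grid U" for l
      unfolding q(4)[OF that] half_Delta_def using q(3)[OF that]
      by (simp add: add.assoc divide_diff_eq_iff)
    have rel: "d / (v + a) * (d' / (v' + a)) * (v - v') = d * (d' / (v' + a)) - d' * (d / (v + a))"
      if "v + a \<noteq> 0" "v' + a \<noteq> 0" for d d' v v' :: real
      using that by (simp add: divide_simps) (simp add: algebra_simps)
    show ?thesis
      by (rule iffD2[OF dEPD_separated[where h = h and c = c and g = g and U = U,
            OF h ij grid q(1)[OF grid(2)] q(1)[OF grid(3)] False uij]])
        (simp_all only: r[OF grid(2)] r[OF grid(3)] rel[OF q(3)[OF grid(2)] q(3)[OF grid(3)]])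
  next
    case True
    \<comment> \<open>As \<open>g i\<close> and \<open>g j\<close> do not vanish, a zero of \<open>h\<close> persists in both directions.\<close>
    have hi: "h (n + axis i 1) = 0"
      using factorized_unit_step[where h = h and g = g, OF h grid(1,2) q(1)[OF grid(2)]] True
      by simp
    have hj: "h (n + axis j 1) = 0"
      using factorized_unit_step[where h = h and g = g, OF h grid(1,3) q(1)[OF grid(3)]] True
      by simp
    have nj: "(n + axis i 1) $ j = n $ j" using ij by (simp add: axis_def)
    have "h (n + axis i 1 + axis j 1) = 0"
      using factorized_unit_step[where h = h and g = g, OF h grid(2,4)] q(1)[OF grid(3)] hi
      unfolding nj by simp
    with True hi hj show ?thesis by (simp add: Delta_def)
  qed
qed

section \<open>Separation constants\<close>

text \<open>
  Here \<open>A i s\<close> stands for \<open>\<rho>\<^sub>i - 1\<close> and \<open>d i s\<close> for the difference of \<open>u\<^sub>i\<close>, on the set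
  \<open>D i\<close> of admissible base points.  Since \<open>d\<close> never vanishes, a single zero of \<open>A\<close> forces
  \<open>A\<close> to vanish in every other direction, and through a second direction everywhere.
\<close>

lemma separation_dichotomy:
  fixes A d v :: "'n::finite \<Rightarrow> real \<Rightarrow> real"
  assumes N: "CARD('n) \<ge> 2"
    and D: "\<And>i. D i \<noteq> {}"
    and d: "\<And>i s. s \<in> D i \<Longrightarrow> d i s \<noteq> 0"
    and eq: "\<And>i j s t. i \<noteq> j \<Longrightarrow> s \<in> D i \<Longrightarrow> t \<in> D j \<Longrightarrow>
      A i s * A j t * (v i s - v j t) = d i s * A j t - d j t * A i s"
  shows "(\<forall>i. \<forall>s\<in>D i. A i s = 0) \<or>
    (\<exists>a. \<forall>i. \<forall>s\<in>D i. v i s + a \<noteq> 0 \<and> A i s = d i s / (v i s + a))"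
proof -
  have other: "\<exists>j. j \<noteq> i" for i :: 'n
  proof (rule ccontr)
    assume "\<nexists>j. j \<noteq> i"
    then have "(UNIV :: 'n set) = {i}" by auto
    then have "CARD('n) = 1" by (metis card_1_singleton_iff One_nat_def)
    with N show False by simp
  qed
  show ?thesis
  proof (cases "\<exists>i. \<exists>s\<in>D i. A i s = 0")
    case True
    then obtain i s where i0: "s \<in> D i" "A i s = 0" by blast
    have spread: "A j t = 0" if "i \<noteq> j" "s \<in> D i" "A i s = 0" "t \<in> D j" for i j s t
      using eq[OF that(1,2,4)] d[OF that(2)] that(3) by simp
    obtain j where j: "j \<noteq> i" using other by blast
    obtain t where t: "t \<in> D j" using D by blast
    have jt: "A j t = 0" using spread[OF j[symmetric] i0 t] .
    have "A l r = 0" if "r \<in> D l" for l r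
      using spread[OF _ i0 that] spread[OF _ t jt that] j by (cases "l = i") auto
    then show ?thesis by blast
  next
    case False
    let ?a = "\<lambda>i s. d i s / A i s - v i s"
    have nz: "A i s \<noteq> 0" if "s \<in> D i" for i s using False that by blast
    have same: "?a i s = ?a j t" if "i \<noteq> j" "s \<in> D i" "t \<in> D j" for i j s t
      using eq[OF that] nz[OF that(2)] nz[OF that(3)] by (simp add: field_simps)
    obtain i :: 'n where True by blast
    obtain s where s: "s \<in> D i" using D by blast
    obtain j where j: "j \<noteq> i" using other by blast
    obtain t where t: "t \<in> D j" using D by blast
    have const: "?a l r = ?a i s" if "r \<in> D l" for l r
      using same[OF _ that s] same[OF _ that t] same[OF j t s] j by (cases "l = i") auto
    have "v l r + ?a i s \<noteq> 0 \<and> A l r = d l r / (v l r + ?a i s)" if "r \<in> D l" for l r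
    proof -
      have "v l r + ?a i s = d l r / A l r" using const[OF that] by linarith
      then show ?thesis using nz[OF that] d[OF that] by simp
    qed
    then show ?thesis by blast
  qed
qed

text \<open>
  A one-variable ratio of \<open>h\<close> at an arbitrary pair of unit steps is realized at a grid point
  by freezing all other coordinates at base points \<open>p\<close>.
\<close>

lemma factorized_solution_dichotomy:
  fixes U :: "'n::finite \<Rightarrow> real set" and u g :: "'n \<Rightarrow> real \<Rightarrow> real"
  assumes N: "CARD('n) \<ge> 2"
    and U: "\<And>i. consecutive_half_ints (U i)"
    and p: "\<And>i. p i \<in> U i" "\<And>i. p i + 1 \<in> U i"
    and u_step: "\<And>i m. m \<in> quarter_points (U i) \<Longrightarrow> m + 1/2 \<in> quarter_points (U i) \<Longrightarrow>
           u i (m + 1/2) \<noteq> u i m"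
    and u_sep: "\<And>i j m m'. i \<noteq> j \<Longrightarrow> m \<in> quarter_points (U i) \<Longrightarrow> m' \<in> quarter_points (U j) \<Longrightarrow>
           u i m \<noteq> u j m'"
    and h: "\<And>m. m \<in> grid U \<Longrightarrow> h m = (\<Prod>i\<in>UNIV. g i (m $ i))"
    and nz: "\<And>m. m \<in> grid U \<Longrightarrow> h m \<noteq> 0"
    and sol: "dEPD U u h"
  shows "(\<forall>i t. t \<in> U i \<and> t + 1 \<in> U i \<longrightarrow> g i (t + 1) = g i t) \<or> (\<exists>a. separation_constant U u g a)"
proof -
  have g: "g i t \<noteq> 0" if "t \<in> U i" for i t
  proof -
    define n where "n = (\<chi> l. if l = i then t else p l)"
    have "n \<in> grid U" using that p by (simp add: grid_def n_def)
    then have "(\<Prod>l\<in>UNIV. g l (n $ l)) \<noteq> 0" using h nz by metis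
    then have "g i (n $ i) \<noteq> 0" by simp
    then show ?thesis by (simp add: n_def)
  qed
  define D where "D i = {t. t \<in> U i \<and> t + 1 \<in> U i}" for i
  define A where "A i t = g i (t + 1) / g i t - 1" for i t
  define d where "d i t = half_Delta (u i) (t + 1/4)" for i t
  define v where "v i t = u i (t + 1/4)" for i t
  have d_eq: "d i t = u i (t + 3/4) - u i (t + 1/4)" for i t
    by (simp add: d_def half_Delta_def add.assoc)
  have D: "D i \<noteq> {}" for i using p by (auto simp: D_def)
  have qp: "t + 1/4 \<in> quarter_points (U i)" "t + 3/4 \<in> quarter_points (U i)" if "t \<in> D i" for i t
    using quarter_points_of_unit_step[OF U] that by (auto simp: D_def)
  have d: "d i t \<noteq> 0" if "t \<in> D i" for i t
    using u_step[of "t + 1/4" i] qp[OF that] by (simp add: d_eq add.assoc)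
  have eq: "A i s * A j t * (v i s - v j t) = d i s * A j t - d j t * A i s"
    if ij: "i \<noteq> j" and s: "s \<in> D i" and t: "t \<in> D j" for i j s t
  proof -
    define n where "n = (\<chi> l. if l = i then s else if l = j then t else p l)"
    have nij: "n $ i = s" "n $ j = t" using ij by (auto simp: n_def)
    have grid: "n \<in> grid U" "n + axis i 1 \<in> grid U" "n + axis j 1 \<in> grid U"
      "n + axis i 1 + axis j 1 \<in> grid U"
      using s t p ij by (auto simp: grid_def n_def axis_def D_def)
    have "Delta i (Delta j h) n = 1 / (v i s - v j t) * (d i s * Delta j h n - d j t * Delta i h n)"
      using sol ij grid unfolding dEPD_def v_def d_def nij[symmetric] by blast
    moreover have "g i (n $ i) \<noteq> 0" "g j (n $ j) \<noteq> 0"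
      using g s t by (auto simp: nij D_def)
    moreover have "v i s \<noteq> v j t" unfolding v_def by (rule u_sep[OF ij qp(1)[OF s] qp(1)[OF t]])
    ultimately show ?thesis
      using dEPD_separated[where h = h and c = 1 and g = g and U = U, OF _ ij grid _ _ nz[OF grid(1)],
          of "v i s" "v j t" "d i s" "d j t"] h
      by (simp add: nij A_def)
  qed
  from separation_dichotomy[where A = A and d = d and v = v and D = D, OF N D d eq]
  show ?thesis
  proof
    assume *: "\<forall>i. \<forall>s\<in>D i. A i s = 0"
    have "g i (t + 1) = g i t" if "t \<in> U i" "t + 1 \<in> U i" for i t
    proof -
      have "A i t = 0" using * that by (simp add: D_def)
      then show ?thesis using g[OF that(1)] by (simp add: A_def field_simps)
    qed
    then show ?thesis by blast
  next
    assume "\<exists>a. \<forall>i. \<forall>s\<in>D i. v i s + a \<noteq> 0 \<and> A i s = d i s / (v i s + a)"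
    then obtain a where a: "\<And>i s. s \<in> D i \<Longrightarrow> v i s + a \<noteq> 0"
      "\<And>i s. s \<in> D i \<Longrightarrow> A i s = d i s / (v i s + a)" by blast
    have "u i (t + 1/4) + a \<noteq> 0 \<and>
        g i (t + 1) / g i t = (u i (t + 3/4) + a) / (u i (t + 1/4) + a)"
      if "t \<in> U i" "t + 1 \<in> U i" for i t
    proof -
      have t: "t \<in> D i" using that by (simp add: D_def)
      have nz: "u i (t + 1/4) + a \<noteq> 0" using a(1)[OF t] by (simp add: v_def)
      have "g i (t + 1) / g i t = 1 + (u i (t + 3/4) - u i (t + 1/4)) / (u i (t + 1/4) + a)"
        using a(2)[OF t] unfolding A_def d_eq v_def by linarith
      then show ?thesis using nz by (simp add: field_simps)
    qed
    then show ?thesis unfolding separation_constant_def by blast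
  qed
qed

section \<open>Independence and the ordering of the constants\<close>

text \<open>
  The \<open>N\<close> forward differences are independent, so they span the whole space, and a common
  normal is orthogonal to itself.
\<close>

lemma common_normal_zero:
  fixes x :: "real ^ 'n \<Rightarrow> real ^ 'n::finite"
  assumes x: "discrete_coordinate_system U x"
    and n: "n \<in> grid U" "\<And>j. n + axis j 1 \<in> grid U"
    and c: "\<And>j. c \<bullet> (x (n + axis j 1) - x n) = 0"
  shows "c = 0"
proof -
  define v where "v j = x (n + axis j 1) - x n" for j
  have "\<forall>j. (n + axis j 1 \<in> grid U \<and> v j = x (n + axis j 1) - x n) \<or>
      (n - axis j 1 \<in> grid U \<and> v j = x n - x (n - axis j 1))"
    using n(2) by (simp add: v_def)
  then have v: "inj v" "independent (range v)"
    using x n(1) unfolding discrete_coordinate_system_def by auto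
  have "card (range v) = CARD('n)" using v(1) by (simp add: card_image)
  then have "UNIV \<subseteq> span (range v)"
    using v(2) by (intro card_ge_dim_independent) (auto simp: dim_UNIV)
  then have "c \<in> span (range v)" by blast
  then have "orthogonal c c"
    by (rule orthogonal_to_span) (use c in \<open>auto simp: orthogonal_def v_def\<close>)
  then show ?thesis by (simp add: orthogonal_def)
qed

lemma rank_properties:
  fixes f :: "'a::finite \<Rightarrow> 'b::linorder"
  assumes f: "inj f"
  defines "rk \<equiv> \<lambda>k. card {l. f l < f k}"
  shows "rk k < rk l \<longleftrightarrow> f k < f l" and "bij_betw rk UNIV {..<CARD('a)}"
proof -
  have less: "rk k < rk l" if "f k < f l" for k l
    unfolding rk_def using that by (intro psubset_card_mono) auto
  show *: "rk k < rk l \<longleftrightarrow> f k < f l" for k l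
    using less[of k l] less[of l k] injD[OF f, of k l]
    by (cases "f k" "f l" rule: linorder_cases) auto
  have inj: "inj rk"
    using * injD[OF f] by (intro injI) (metis less_irrefl linorder_neqE)
  have "range rk \<subseteq> {..<CARD('a)}"
    unfolding rk_def by (auto intro!: psubset_card_mono)
  then have "range rk = {..<CARD('a)}"
    using inj by (intro card_subset_eq) (auto simp: card_image)
  with inj show "bij_betw rk UNIV {..<CARD('a)}" by (simp add: bij_betw_def)
qed

text \<open>The arrangement matches the rank of an index with the rank of its value.\<close>

lemma ex_strictly_decreasing_arrangement:
  fixes a :: "'n::{finite,linorder} \<Rightarrow> real"
  assumes "inj a"
  shows "\<exists>\<sigma> :: 'n \<Rightarrow> 'n. bij \<sigma> \<and> strictly_decreasing (a \<circ> \<sigma>)"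
proof -
  define r where "r k = card {l :: 'n. id l < id k}" for k
  define s where "s k = card {l. - a l < - a k}" for k
  have ia: "inj (\<lambda>k. - a k)" using assms by (auto simp: inj_def)
  have r: "r k < r l \<longleftrightarrow> k < l" "bij_betw r UNIV {..<CARD('n)}" for k l
    using rank_properties[of "id :: 'n \<Rightarrow> 'n"] unfolding r_def by simp_all
  have s: "s k < s l \<longleftrightarrow> a l < a k" "bij_betw s UNIV {..<CARD('n)}" for k l
    using rank_properties[OF ia] unfolding s_def by simp_all
  define \<sigma> where "\<sigma> = the_inv_into UNIV s \<circ> r"
  have "bij \<sigma>"
    unfolding \<sigma>_def using r(2) bij_betw_the_inv_into[OF s(2)] by (rule bij_betw_trans)
  moreover have "s (\<sigma> k) = r k" for k
  proof -
    have "r k \<in> range s" using r(2) s(2) by (auto simp: bij_betw_def)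
    then show ?thesis
      using s(2) by (simp add: \<sigma>_def f_the_inv_into_f bij_betw_def)
  qed
  then have "strictly_decreasing (a \<circ> \<sigma>)"
    unfolding strictly_decreasing_def by (metis comp_apply r(1) s(1))
  ultimately show ?thesis by blast
qed

section \<open>Factorized solutions are confocal coordinates\<close>

lemma interlacing_sign:
  assumes "strictly_decreasing b" "interlacing U u b" "m \<in> quarter_points (U i)"
  shows "0 < (if k \<le> i then u i m + b k else - (u i m + b k))"
proof (cases "k \<le> i")
  case True
  have "b i \<le> b k"
    using True assms(1) unfolding strictly_decreasing_def by (metis order_le_less)
  moreover have "- b i < u i m" using assms(2,3) unfolding interlacing_def by blast
  ultimately show ?thesis using True by simp
next
  case False
  then have "u i m < - b k" using assms(2,3) unfolding interlacing_def by (meson not_le)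
  then show ?thesis using False by simp
qed

text \<open>
  The separated quotient \<open>g(t + 1) / g(t)\<close> is the quotient of the neighbouring products
  \<open>g(t + 1/2) g(t + 1)\<close> and \<open>g(t) g(t + 1/2)\<close>, so these are proportional to \<open>u + b\<close>.
\<close>

lemma half_step_products_proportional:
  fixes g w :: "real \<Rightarrow> real"
  assumes S: "consecutive_half_ints S"
    and w: "\<And>m. m \<in> quarter_points S \<Longrightarrow> 0 < w m"
    and pos: "\<And>t. t \<in> S \<Longrightarrow> t + 1/2 \<in> S \<Longrightarrow> 0 < g t * g (t + 1/2)"
    and quot: "\<And>t. t \<in> S \<Longrightarrow> t + 1 \<in> S \<Longrightarrow> g (t + 1) / g t = w (t + 3/4) / w (t + 1/4)"
  shows "\<exists>\<kappa>>0. \<forall>t. t \<in> S \<and> t + 1/2 \<in> S \<longrightarrow> g t * g (t + 1/2) = \<kappa> * w (t + 1/4)"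
proof (cases "\<exists>s. s \<in> S \<and> s + 1/2 \<in> S")
  case True
  then obtain s where s: "s \<in> S" "s + 1/2 \<in> S" by blast
  define \<phi> where "\<phi> t = g t * g (t + 1/2) / w (t + 1/4)" for t
  have wt: "0 < w (t + 1/4)" if "t \<in> S" "t + 1/2 \<in> S" for t
    using w that unfolding quarter_points_def by blast
  have step: "\<phi> (t + 1/2) = \<phi> t" if t: "t \<in> S" "t + 1 \<in> S" for t
  proof -
    have qp: "w (t + 1/4) \<noteq> 0" "w (t + 3/4) \<noteq> 0"
      using w quarter_points_of_unit_step[OF S t] by (metis less_irrefl)+
    have "0 < g t * g (t + 1/2)" by (rule pos[OF t(1) consecutive_half_ints_mid[OF S t]])
    then have "g t \<noteq> 0" by auto
    then have cross: "g (t + 1) * w (t + 1/4) = g t * w (t + 3/4)"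
      using quot[OF t] qp(1) by (simp add: frac_eq_eq mult.commute)
    have "\<phi> (t + 1/2) = g (t + 1/2) * g (t + 1) / w (t + 3/4)"
      by (simp add: \<phi>_def add.assoc)
    also have "\<dots> = g t * g (t + 1/2) / w (t + 1/4)"
      unfolding frac_eq_eq[OF qp(2,1)] using cross by algebra
    finally show ?thesis by (simp add: \<phi>_def)
  qed
  have "g t * g (t + 1/2) = \<phi> s * w (t + 1/4)" if t: "t \<in> S" "t + 1/2 \<in> S" for t
  proof -
    have "\<phi> s = \<phi> t" by (rule half_step_invariant_const[where \<phi> = \<phi>, OF S step s t])
    then show ?thesis using wt[OF t] by (simp add: \<phi>_def)
  qed
  moreover have "\<phi> s > 0" using pos[OF s] wt[OF s] by (simp add: \<phi>_def)
  ultimately show ?thesis by blast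
qed (auto intro: exI[of _ 1])

text \<open>
  Dividing each factor \<open>g k i\<close> by the square root of its proportionality constant \<open>\<kappa> k i\<close>
  normalizes its half-step products to the prescribed ones.  The scaling \<open>C k\<close> collects these
  square roots and the normalizing denominator \<open>Q k\<close>.
\<close>

lemma confocal_of_separated:
  fixes U :: "'n::{finite,linorder} \<Rightarrow> real set" and u :: "'n \<Rightarrow> real \<Rightarrow> real"
    and x :: "(real, 'n) vec \<Rightarrow> (real, 'n) vec"
  assumes U: "\<And>i. consecutive_half_ints (U i)"
    and dec: "strictly_decreasing b" and inter: "interlacing U u b"
    and fact: "factorized U g x"
    and xpos: "\<And>n k. n \<in> grid U \<Longrightarrow> x n $ k > 0"
    and sep: "\<And>k. separation_constant U u (g k) (b k)"
    and pos: "\<And>k i t. t \<in> U i \<Longrightarrow> t + 1/2 \<in> U i \<Longrightarrow> g k i t * g k i (t + 1/2) > 0"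
  shows "\<exists>C y. (\<forall>k. C k > 0) \<and> confocal U u b y \<and> (\<forall>n \<in> grid U. \<forall>k. y n $ k > 0) \<and>
    (\<forall>n \<in> grid U. \<forall>k. x n $ k = C k * y n $ k)"
proof -
  define w where "w k i m = (if k \<le> i then u i m + b k else - (u i m + b k))" for k i m
  define P where "P k i c \<longleftrightarrow> c > 0 \<and>
      (\<forall>t. t \<in> U i \<and> t + 1/2 \<in> U i \<longrightarrow> g k i t * g k i (t + 1/2) = c * w k i (t + 1/4))" for k i c
  have ex: "\<exists>c. P k i c" for k i
    unfolding P_def
  proof (rule half_step_products_proportional[where g = "g k i" and S = "U i" for k i, OF U _ pos])
    show "0 < w k i m" if "m \<in> quarter_points (U i)" for m
      unfolding w_def by (rule interlacing_sign[OF dec inter that])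
    show "g k i (t + 1) / g k i t = w k i (t + 3/4) / w k i (t + 1/4)"
      if t: "t \<in> U i" "t + 1 \<in> U i" for t
    proof -
      have "g k i (t + 1) / g k i t = (u i (t + 3/4) + b k) / (u i (t + 1/4) + b k)"
        using sep t unfolding separation_constant_def by blast
      then show ?thesis
        unfolding w_def by (cases "k \<le> i") (simp_all only: if_True if_False minus_divide_divide)
    qed
  qed
  define \<kappa> where "\<kappa> k i = (SOME c. P k i c)" for k i
  have "P k i (\<kappa> k i)" for k i
    unfolding \<kappa>_def by (rule someI_ex[OF ex])
  then have \<kappa>: "\<And>k i. \<kappa> k i > 0"
    "\<And>k i t. t \<in> U i \<Longrightarrow> t + 1/2 \<in> U i \<Longrightarrow> g k i t * g k i (t + 1/2) = \<kappa> k i * w k i (t + 1/4)"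
    unfolding P_def by blast+
  define F where "F k i t = g k i t / sqrt (\<kappa> k i)" for k i t
  define Q where "Q k = (\<Prod>i\<in>{..<k}. sqrt (b i - b k)) * (\<Prod>i\<in>{k<..}. sqrt (b k - b i))" for k
  define y where "y n = (\<chi> k. (\<Prod>j\<in>UNIV. F k j (n $ j)) / Q k)" for n :: "(real, 'n) vec"
  define C where "C k = Q k * (\<Prod>j\<in>UNIV. sqrt (\<kappa> k j))" for k
  have Q: "Q k > 0" for k
    unfolding Q_def using dec by (intro mult_pos_pos prod_pos) (auto simp: strictly_decreasing_def)
  have C: "C k > 0" for k
    unfolding C_def using Q \<kappa>(1) by (intro mult_pos_pos prod_pos) auto
  have "F k i t * F k i (t + 1/2) = w k i (t + 1/4)" if "t \<in> U i" "t + 1/2 \<in> U i" for k i t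
  proof -
    have "F k i t * F k i (t + 1/2) = (g k i t * g k i (t + 1/2)) / \<kappa> k i"
      using \<kappa>(1)[of k i] by (simp add: F_def)
    then show ?thesis using \<kappa>(1)[of k i] \<kappa>(2)[OF that] by simp
  qed
  then have conf: "confocal U u b y"
    unfolding confocal_def by (intro exI[of _ F]) (auto simp: w_def y_def Q_def)
  have xy: "x n $ k = C k * y n $ k" if "n \<in> grid U" for n k
  proof -
    have "(\<Prod>j\<in>UNIV. F k j (n $ j)) * (\<Prod>j\<in>UNIV. sqrt (\<kappa> k j)) = (\<Prod>j\<in>UNIV. g k j (n $ j))"
      unfolding prod.distrib[symmetric]
    proof (rule prod.cong)
      fix j
      have "sqrt (\<kappa> k j) \<noteq> 0" using \<kappa>(1)[of k j] by simp
      then show "F k j (n $ j) * sqrt (\<kappa> k j) = g k j (n $ j)" by (simp add: F_def)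
    qed simp
    then have "C k * y n $ k = (\<Prod>j\<in>UNIV. g k j (n $ j))"
      using Q[of k] by (simp add: C_def y_def mult.commute)
    then show ?thesis using fact that unfolding factorized_def by simp
  qed
  have "y n $ k > 0" if "n \<in> grid U" for n k
    using xpos[OF that, of k] xy[OF that, of k] C[of k] by (simp add: zero_less_mult_iff)
  with C conf xy show ?thesis by blast
qed

theorem theoremA2:
  fixes U :: "'n::{finite,linorder} \<Rightarrow> real set"
    and u :: "'n \<Rightarrow> real \<Rightarrow> real"
  assumes "CARD('n) \<ge> 2"
    and "\<And>i. consecutive_half_ints (U i)"
    and "\<And>i. finite (U i) \<Longrightarrow> card (U i) \<ge> 3"
    and "\<And>i m. m \<in> quarter_points (U i) \<Longrightarrow> m + 1/2 \<in> quarter_points (U i) \<Longrightarrow>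
           u i (m + 1/2) \<noteq> u i m"
    and "\<And>i j m m'. i \<noteq> j \<Longrightarrow> m \<in> quarter_points (U i) \<Longrightarrow> m' \<in> quarter_points (U j) \<Longrightarrow>
           u i m \<noteq> u j m'"
  shows
    "(\<forall>(a :: 'n \<Rightarrow> real) (x :: (real, 'n) vec \<Rightarrow> (real, 'n) vec).
        strictly_decreasing a \<and>
        (\<forall>i k. \<forall>m \<in> quarter_points (U i). u i m \<noteq> - a k) \<and>
        confocal U u a x \<longrightarrow>
        (\<forall>k. dEPD U u (\<lambda>n. x n $ k)))
     \<and>
     (\<forall>(f :: 'n \<Rightarrow> 'n \<Rightarrow> real \<Rightarrow> real) (x :: (real, 'n) vec \<Rightarrow> (real, 'n) vec).
        factorized U f x \<and>
        (\<forall>k. dEPD U u (\<lambda>n. x n $ k)) \<and>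
        discrete_coordinate_system U x \<and>
        (\<forall>n \<in> grid U. \<forall>k. x n $ k > 0) \<and>
        (\<forall>k i t. t \<in> U i \<and> t + 1/2 \<in> U i \<longrightarrow> f k i t * f k i (t + 1/2) > 0) \<longrightarrow>
        (\<forall>k. \<exists>a. separation_constant U u (f k) a) \<and>
        (\<forall>a :: 'n \<Rightarrow> real. (\<forall>k. separation_constant U u (f k) (a k)) \<longrightarrow>
           (\<exists>\<sigma> :: 'n \<Rightarrow> 'n. bij \<sigma> \<and> strictly_decreasing (a \<circ> \<sigma>)) \<and>
           (\<forall>\<sigma> :: 'n \<Rightarrow> 'n. bij \<sigma> \<and> strictly_decreasing (a \<circ> \<sigma>) \<and> interlacing U u (a \<circ> \<sigma>) \<longrightarrow>
              (\<exists>(C :: 'n \<Rightarrow> real) (y :: (real, 'n) vec \<Rightarrow> (real, 'n) vec).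
                 (\<forall>k. C k > 0) \<and>
                 confocal U u (a \<circ> \<sigma>) y \<and>
                 (\<forall>n \<in> grid U. \<forall>k. y n $ k > 0) \<and>
                 (\<forall>n \<in> grid U. \<forall>k. x n $ \<sigma> k = C k * y n $ k)))))"
proof (rule conjI, goal_cases)
  case 1
  show ?case
  proof (intro allI impI, elim conjE)
    fix a :: "'n \<Rightarrow> real" and x :: "(real, 'n) vec \<Rightarrow> (real, 'n) vec" and k
    assume ua: "\<forall>i k. \<forall>m \<in> quarter_points (U i). u i m \<noteq> - a k"
      and "confocal U u a x"
    then obtain f where f: "\<And>k i t. t \<in> U i \<Longrightarrow> t + 1/2 \<in> U i \<Longrightarrow> f k i t * f k i (t + 1/2) =
        (if k \<le> i then u i (t + 1/4) + a k else - (u i (t + 1/4) + a k))"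
      and x: "\<And>n k. n \<in> grid U \<Longrightarrow> x n $ k = (\<Prod>j\<in>UNIV. f k j (n $ j)) /
             ((\<Prod>i\<in>{..<k}. sqrt (a i - a k)) * (\<Prod>i\<in>{k<..}. sqrt (a k - a i)))"
      unfolding confocal_def by blast
    show "dEPD U u (\<lambda>n. x n $ k)"
    proof (rule dEPD_of_half_step_products[where g = "f k" and a = "a k"
          and e = "\<lambda>i. if k \<le> i then 1 else - 1"
          and c = "1 / ((\<Prod>i\<in>{..<k}. sqrt (a i - a k)) * (\<Prod>i\<in>{k<..}. sqrt (a k - a i)))"])
      show "u i m + a k \<noteq> 0" if "m \<in> quarter_points (U i)" for i m
        using ua that by (metis add_eq_0_iff2)
    qed (use assms(2,5) x f in auto)
  qed
next
  case 2
  obtain p where p: "\<And>i. p i \<in> U i" "\<And>i. p i + 1 \<in> U i"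
    using unit_step_exists[OF assms(2,3)] by metis
  define n :: "(real, 'n) vec" where "n = (\<chi> i. p i)"
  have n: "n \<in> grid U" "n + axis j 1 \<in> grid U" for j
    using p by (auto simp: n_def grid_def axis_def)
  show ?case
  proof (intro allI impI, elim conjE)
    fix f :: "'n \<Rightarrow> 'n \<Rightarrow> real \<Rightarrow> real" and x :: "(real, 'n) vec \<Rightarrow> (real, 'n) vec"
    assume fact: "factorized U f x" and sol: "\<forall>k. dEPD U u (\<lambda>n. x n $ k)"
      and ind: "discrete_coordinate_system U x"
      and xpos: "\<forall>n \<in> grid U. \<forall>k. x n $ k > 0"
      and fpos: "\<forall>k i t. t \<in> U i \<and> t + 1/2 \<in> U i \<longrightarrow> f k i t * f k i (t + 1/2) > 0"
    have xf: "x m $ k = (\<Prod>i\<in>UNIV. f k i (m $ i))" if "m \<in> grid U" for m k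
      using fact that unfolding factorized_def by blast
    have f0: "f k i (n $ i) \<noteq> 0" for k i
    proof -
      have "(\<Prod>i\<in>UNIV. f k i (n $ i)) \<noteq> 0"
        unfolding xf[OF n(1), symmetric] using xpos n(1) by (auto simp: less_le)
      then show ?thesis by simp
    qed
    have x_step: "x (n + axis j 1) $ k = x n $ k * (f k j (n $ j + 1) / f k j (n $ j))" for j k
      by (rule factorized_unit_step[where h = "\<lambda>n. x n $ k" and g = "f k" and c = 1, OF _ n f0])
        (simp add: xf)

    have "\<exists>a. separation_constant U u (f k) a" for k
    proof (rule ccontr)
      assume no: "\<nexists>a. separation_constant U u (f k) a"
      have "(\<forall>i t. t \<in> U i \<and> t + 1 \<in> U i \<longrightarrow> f k i (t + 1) = f k i t) \<or>
          (\<exists>a. separation_constant U u (f k) a)"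
      proof (rule factorized_solution_dichotomy[where h = "\<lambda>n. x n $ k" and p = p])
        show "x m $ k \<noteq> 0" if "m \<in> grid U" for m
          using xpos that by (auto simp: less_le)
        show "dEPD U u (\<lambda>n. x n $ k)" using sol by blast
      qed (fact assms(1,2,4,5) p xf)+
      then have const: "f k i (t + 1) = f k i t" if "t \<in> U i" "t + 1 \<in> U i" for i t
        using no that by blast
      have "axis k 1 \<bullet> (x (n + axis j 1) - x n) = 0" for j
      proof -
        have "f k j (n $ j + 1) = f k j (n $ j)" using const p by (simp add: n_def)
        then show ?thesis using x_step[of j k] f0[of k j] by (simp add: inner_axis')
      qed
      then have "axis k (1::real) = 0" by (rule common_normal_zero[OF ind n])
      then show False by (simp add: axis_eq_0_iff)
    qed
    moreover
    have "(\<exists>\<sigma> :: 'n \<Rightarrow> 'n. bij \<sigma> \<and> strictly_decreasing (a \<circ> \<sigma>)) \<and>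
           (\<forall>\<sigma> :: 'n \<Rightarrow> 'n. bij \<sigma> \<and> strictly_decreasing (a \<circ> \<sigma>) \<and> interlacing U u (a \<circ> \<sigma>) \<longrightarrow>
              (\<exists>(C :: 'n \<Rightarrow> real) (y :: (real, 'n) vec \<Rightarrow> (real, 'n) vec).
                 (\<forall>k. C k > 0) \<and>
                 confocal U u (a \<circ> \<sigma>) y \<and>
                 (\<forall>n \<in> grid U. \<forall>k. y n $ k > 0) \<and>
                 (\<forall>n \<in> grid U. \<forall>k. x n $ \<sigma> k = C k * y n $ k)))"
      if sep: "\<forall>k. separation_constant U u (f k) (a k)" for a
    proof (intro conjI allI impI)
      have "inj a"
      proof (rule injI, rule ccontr)
        fix k l
        assume kl: "a k = a l" "k \<noteq> l"
        \<comment> \<open>Equal constants give equal logarithmic differences of \<open>x\<^sub>k\<close> and \<open>x\<^sub>l\<close>.\<close>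
        define c where "c = x n $ l *\<^sub>R axis k 1 - x n $ k *\<^sub>R axis l (1::real)"
        have "c \<bullet> (x (n + axis j 1) - x n) = 0" for j
        proof -
          have t: "n $ j \<in> U j \<and> n $ j + 1 \<in> U j" using p by (simp add: n_def)
          have "f k j (n $ j + 1) / f k j (n $ j) = f l j (n $ j + 1) / f l j (n $ j)"
            using sep t kl(1) unfolding separation_constant_def by metis
          then show ?thesis
            by (simp add: c_def inner_diff_left inner_axis' x_step algebra_simps)
        qed
        then have "c = 0" by (rule common_normal_zero[OF ind n])
        then have "c $ k = 0" by simp
        then have "x n $ l = 0" using kl(2) by (simp add: c_def axis_def)
        moreover have "x n $ l > 0" using xpos n(1) by blast
        ultimately show False by simp
      qed
      then show "\<exists>\<sigma> :: 'n \<Rightarrow> 'n. bij \<sigma> \<and> strictly_decreasing (a \<circ> \<sigma>)"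
        by (rule ex_strictly_decreasing_arrangement)
    next
      fix \<sigma> :: "'n \<Rightarrow> 'n"
      assume \<sigma>: "bij \<sigma> \<and> strictly_decreasing (a \<circ> \<sigma>) \<and> interlacing U u (a \<circ> \<sigma>)"
      define z where "z m = (\<chi> k. x m $ \<sigma> k)" for m
      have "factorized U (f \<circ> \<sigma>) z"
        using xf by (simp add: factorized_def z_def)
      from confocal_of_separated[where b = "a \<circ> \<sigma>" and x = z and g = "f \<circ> \<sigma>" and u = u,
          OF assms(2) _ _ this]
      obtain C y where Cy: "\<forall>k. C k > 0" "confocal U u (a \<circ> \<sigma>) y" "\<forall>n \<in> grid U. \<forall>k. y n $ k > 0"
        "\<forall>n \<in> grid U. \<forall>k. z n $ k = C k * y n $ k"
        using \<sigma> sep fpos xpos unfolding z_def by auto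
      then show "\<exists>C y. (\<forall>k. C k > 0) \<and> confocal U u (a \<circ> \<sigma>) y \<and>
          (\<forall>n \<in> grid U. \<forall>k. y n $ k > 0) \<and> (\<forall>n \<in> grid U. \<forall>k. x n $ \<sigma> k = C k * y n $ k)"
        by (intro exI[of _ C] exI[of _ y]) (simp add: z_def)
    qed
    ultimately show "(\<forall>k. \<exists>a. separation_constant U u (f k) a) \<and>
        (\<forall>a :: 'n \<Rightarrow> real. (\<forall>k. separation_constant U u (f k) (a k)) \<longrightarrow>
           (\<exists>\<sigma> :: 'n \<Rightarrow> 'n. bij \<sigma> \<and> strictly_decreasing (a \<circ> \<sigma>)) \<and>
           (\<forall>\<sigma> :: 'n \<Rightarrow> 'n. bij \<sigma> \<and> strictly_decreasing (a \<circ> \<sigma>) \<and> interlacing U u (a \<circ> \<sigma>) \<longrightarrow>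
              (\<exists>(C :: 'n \<Rightarrow> real) (y :: (real, 'n) vec \<Rightarrow> (real, 'n) vec).
                 (\<forall>k. C k > 0) \<and>
                 confocal U u (a \<circ> \<sigma>) y \<and>
                 (\<forall>n \<in> grid U. \<forall>k. y n $ k > 0) \<and>
                 (\<forall>n \<in> grid U. \<forall>k. x n $ \<sigma> k = C k * y n $ k))))"
      by blast
  qed
qed

end
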